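(* Let $n$ be a positive integer. If a formula $\varphi$ in the language $\mathcal{L}$ is true in $\langle\mathcal{P}^n,C\rangle$, where $C$ is the standard topological contact, then $\varphi$ is a theorem of the formal system $\mathfrak{F}$.
   Context: **The algebra $\langle\mathcal{P}^n,C\rangle$.** $\mathbb{R}^n$ carries its usual topology. A basic polytope in $\mathbb{R}^n$ is a set $\mathrm{Cl}(\mathrm{Int}(\alpha_1\cap\dots\cap\alpha_k))$ with $\alpha_1,\dots,\alpha_k$ finitely many closed half-spaces of $\mathbb{R}^n$; a polytope is a finite union of basic polytopes. $P^n$ is the set of polytopes; with complement $A^*=\mathrm{Cl}(\mathbb{R}^n\setminus A)$ and join $\cup$ it is a Boolean algebra $\mathcal{P}^n$ (zero $\emptyset$, unit $\mathbb{R}^n$). The topological contact is: $C(A,B)$ iff $A\cap B\ne\emptyset$. **The language $\mathcal{L}$.** A countable set of individual variables; equality $\equiv$; connectives $\neg,\vee$; a unary function symbol $-$ and a binary function symbol $+$; a binary predicate symbol $C$. Terms are built from variables by $-$ and $+$. Formulas (quantifier-free) are built from atomic formulas $a\equiv b$, $C(a,b)$ ($a,b$ terms) by $\neg,\vee$. Abbreviations: the usual $\wedge,\Rightarrow,\Leftrightarrow$; $a\cdot b$ is $-((-a)+(-b))$; $0$ is $a\cdot(-a)$ (for a term $a$); $1$ is $-0$; $a\not\equiv b$ is $\neg(a\equiv b)$. **The system $\mathfrak{F}$.** Only rule: modus ponens. Axiom schemes, for all terms $a,b,c$: (1) a complete set of schemes for classical propositional logic; (2) schemes for equality (reflexivity,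 symmetry, transitivity, congruence with respect to $-,+,C$) and for Boolean algebras (associativity, commutativity, absorption and distributivity of $+$ and $\cdot$; $a+(-a)\equiv 1$, $a\cdot(-a)\equiv 0$; $0\not\equiv 1$); (3) $\neg C(0,a)$; $C(a,b+c)\Leftrightarrow(C(a,b)\vee C(a,c))$; $C(a,b)\Rightarrow C(b,a)$; $a\not\equiv 0\Rightarrow C(a,a)$; (4) $a\not\equiv 0\Rightarrow(a\not\equiv 1\Rightarrow C(a,-a))$. **Truth.** In a Boolean algebra equipped with a binary relation, $-$ and $+$ are interpreted as complement and join, the symbol $C$ as the relation, $\equiv$ as equality. A formula is true in the structure iff it is true under every valuation of the variables by elements of the carrier. *)

theory Defs
  imports "HOL-Analysis.Analysis"
begin

section \<open>The Boolean algebra of polytopes with topological contact\<close>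

definition closed_halfspace :: "'a::euclidean_space set \<Rightarrow> bool" where
  "closed_halfspace S \<longleftrightarrow> (\<exists>a b. a \<noteq> 0 \<and> S = {x. a \<bullet> x \<le> b})"

definition basic_polytope :: "'a::euclidean_space set \<Rightarrow> bool" where
  "basic_polytope A \<longleftrightarrow>
     (\<exists>H. finite H \<and> H \<noteq> {} \<and> (\<forall>S\<in>H. closed_halfspace S) \<and> A = closure (interior (\<Inter>H)))"

text \<open>Not to be confused with \<^const>\<open>polytope\<close> of the library (convex hull of a finite
  set): the sets below need be neither convex nor bounded.\<close>

definition polytopes :: "'a::euclidean_space set set" where
  "polytopes = {A. \<exists>F. finite F \<and> (\<forall>B\<in>F. basic_polytope B) \<and> A = \<Union>F}"

text \<open>A Boolean algebra with a binary relation, given by the operations that interpret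
  the symbols of the language; valuations take their values in the carrier.\<close>

record 'a contact_structure =
  carr :: "'a set"
  compl :: "'a \<Rightarrow> 'a"
  join :: "'a \<Rightarrow> 'a \<Rightarrow> 'a"
  contact :: "'a \<Rightarrow> 'a \<Rightarrow> bool"

definition polytope_contact_structure :: "'a::euclidean_space set contact_structure" where
  "polytope_contact_structure =
     \<lparr> carr = polytopes,
       compl = (\<lambda>A. closure (- A)),
       join = (\<union>),
       contact = (\<lambda>A B. A \<inter> B \<noteq> {}) \<rparr>"


section \<open>Language\<close>

datatype trm =
    Var nat
  | TNeg trm  (\<open>\<^bold>- _\<close> [81] 80)
  | TJoin trm trm  (infixl \<open>\<^bold>+\<close> 65)

datatype fm =
    Eq trm trm  (infix \<open>\<^bold>\<equiv>\<close> 50)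
  | Contact trm trm
  | FNot fm  (\<open>\<^bold>\<not> _\<close> [40] 40)
  | FOr fm fm  (infixr \<open>\<^bold>\<or>\<close> 30)

abbreviation TMeet :: "trm \<Rightarrow> trm \<Rightarrow> trm"  (infixl \<open>\<^bold>*\<close> 70) where
  "a \<^bold>* b \<equiv> \<^bold>- ((\<^bold>- a) \<^bold>+ (\<^bold>- b))"

text \<open>The constants are relative to the term \<open>e\<close> chosen to write them.\<close>

abbreviation TZero :: "trm \<Rightarrow> trm" where
  "TZero e \<equiv> e \<^bold>* (\<^bold>- e)"

abbreviation TOne :: "trm \<Rightarrow> trm" where
  "TOne e \<equiv> \<^bold>- (TZero e)"

abbreviation NEq :: "trm \<Rightarrow> trm \<Rightarrow> fm"  (infix \<open>\<^bold>\<noteq>\<close> 50) where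
  "a \<^bold>\<noteq> b \<equiv> \<^bold>\<not> (a \<^bold>\<equiv> b)"

abbreviation FAnd :: "fm \<Rightarrow> fm \<Rightarrow> fm"  (infixr \<open>\<^bold>\<and>\<close> 35) where
  "A \<^bold>\<and> B \<equiv> \<^bold>\<not> ((\<^bold>\<not> A) \<^bold>\<or> (\<^bold>\<not> B))"

abbreviation FImp :: "fm \<Rightarrow> fm \<Rightarrow> fm"  (infixr \<open>\<^bold>\<longrightarrow>\<close> 25) where
  "A \<^bold>\<longrightarrow> B \<equiv> (\<^bold>\<not> A) \<^bold>\<or> B"

abbreviation FIff :: "fm \<Rightarrow> fm \<Rightarrow> fm"  (infix \<open>\<^bold>\<longleftrightarrow>\<close> 24) where
  "A \<^bold>\<longleftrightarrow> B \<equiv> (A \<^bold>\<longrightarrow> B) \<^bold>\<and> (B \<^bold>\<longrightarrow> A)"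


section \<open>Truth\<close>

primrec tval :: "('a, 'z) contact_structure_scheme \<Rightarrow> (nat \<Rightarrow> 'a) \<Rightarrow> trm \<Rightarrow> 'a" where
  "tval M v (Var i) = v i"
| "tval M v (\<^bold>- a) = compl M (tval M v a)"
| "tval M v (a \<^bold>+ b) = join M (tval M v a) (tval M v b)"

primrec holds :: "('a, 'z) contact_structure_scheme \<Rightarrow> (nat \<Rightarrow> 'a) \<Rightarrow> fm \<Rightarrow> bool" where
  "holds M v (a \<^bold>\<equiv> b) \<longleftrightarrow> tval M v a = tval M v b"
| "holds M v (Contact a b) \<longleftrightarrow> contact M (tval M v a) (tval M v b)"
| "holds M v (\<^bold>\<not> A) \<longleftrightarrow> \<not> holds M v A"
| "holds M v (A \<^bold>\<or> B) \<longleftrightarrow> holds M v A \<or> holds M v B"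

definition true_in :: "('a, 'z) contact_structure_scheme \<Rightarrow> fm \<Rightarrow> bool" where
  "true_in M A \<longleftrightarrow> (\<forall>v. (\<forall>i. v i \<in> carr M) \<longrightarrow> holds M v A)"


section \<open>The formal system\<close>

text \<open>Kleene's schemes without those for conjunction, which is defined here from negation and
  disjunction, as is implication. They are complete for classical propositional logic.\<close>

inductive prop_axiom :: "fm \<Rightarrow> bool" where
  "prop_axiom (A \<^bold>\<longrightarrow> (B \<^bold>\<longrightarrow> A))"
| "prop_axiom ((A \<^bold>\<longrightarrow> (B \<^bold>\<longrightarrow> D)) \<^bold>\<longrightarrow> ((A \<^bold>\<longrightarrow> B) \<^bold>\<longrightarrow> (A \<^bold>\<longrightarrow> D)))"
| "prop_axiom (A \<^bold>\<longrightarrow> (A \<^bold>\<or> B))"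
| "prop_axiom (B \<^bold>\<longrightarrow> (A \<^bold>\<or> B))"
| "prop_axiom ((A \<^bold>\<longrightarrow> D) \<^bold>\<longrightarrow> ((B \<^bold>\<longrightarrow> D) \<^bold>\<longrightarrow> ((A \<^bold>\<or> B) \<^bold>\<longrightarrow> D)))"
| "prop_axiom ((A \<^bold>\<longrightarrow> B) \<^bold>\<longrightarrow> ((A \<^bold>\<longrightarrow> (\<^bold>\<not> B)) \<^bold>\<longrightarrow> (\<^bold>\<not> A)))"
| "prop_axiom ((\<^bold>\<not> (\<^bold>\<not> A)) \<^bold>\<longrightarrow> A)"

inductive eq_axiom :: "fm \<Rightarrow> bool" where
  "eq_axiom (a \<^bold>\<equiv> a)"
| "eq_axiom ((a \<^bold>\<equiv> b) \<^bold>\<longrightarrow> (b \<^bold>\<equiv> a))"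
| "eq_axiom ((a \<^bold>\<equiv> b) \<^bold>\<longrightarrow> ((b \<^bold>\<equiv> c) \<^bold>\<longrightarrow> (a \<^bold>\<equiv> c)))"
| "eq_axiom ((a \<^bold>\<equiv> b) \<^bold>\<longrightarrow> ((\<^bold>- a) \<^bold>\<equiv> (\<^bold>- b)))"
| "eq_axiom ((a \<^bold>\<equiv> b) \<^bold>\<longrightarrow> ((c \<^bold>\<equiv> d) \<^bold>\<longrightarrow> ((a \<^bold>+ c) \<^bold>\<equiv> (b \<^bold>+ d))))"
| "eq_axiom ((a \<^bold>\<equiv> b) \<^bold>\<longrightarrow> ((c \<^bold>\<equiv> d) \<^bold>\<longrightarrow> (Contact a c \<^bold>\<longrightarrow> Contact b d)))"

inductive boolean_axiom :: "trm \<Rightarrow> fm \<Rightarrow> bool" for e where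
  "boolean_axiom e ((a \<^bold>+ (b \<^bold>+ c)) \<^bold>\<equiv> ((a \<^bold>+ b) \<^bold>+ c))"
| "boolean_axiom e ((a \<^bold>* (b \<^bold>* c)) \<^bold>\<equiv> ((a \<^bold>* b) \<^bold>* c))"
| "boolean_axiom e ((a \<^bold>+ b) \<^bold>\<equiv> (b \<^bold>+ a))"
| "boolean_axiom e ((a \<^bold>* b) \<^bold>\<equiv> (b \<^bold>* a))"
| "boolean_axiom e ((a \<^bold>+ (a \<^bold>* b)) \<^bold>\<equiv> a)"
| "boolean_axiom e ((a \<^bold>* (a \<^bold>+ b)) \<^bold>\<equiv> a)"
| "boolean_axiom e ((a \<^bold>* (b \<^bold>+ c)) \<^bold>\<equiv> ((a \<^bold>* b) \<^bold>+ (a \<^bold>* c)))"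
| "boolean_axiom e ((a \<^bold>+ (b \<^bold>* c)) \<^bold>\<equiv> ((a \<^bold>+ b) \<^bold>* (a \<^bold>+ c)))"
| "boolean_axiom e ((a \<^bold>+ (\<^bold>- a)) \<^bold>\<equiv> TOne e)"
| "boolean_axiom e ((a \<^bold>* (\<^bold>- a)) \<^bold>\<equiv> TZero e)"
| "boolean_axiom e (TZero e \<^bold>\<noteq> TOne e)"

inductive contact_axiom :: "trm \<Rightarrow> fm \<Rightarrow> bool" for e where
  "contact_axiom e (\<^bold>\<not> Contact (TZero e) a)"
| "contact_axiom e (Contact a (b \<^bold>+ c) \<^bold>\<longleftrightarrow> (Contact a b \<^bold>\<or> Contact a c))"
| "contact_axiom e (Contact a b \<^bold>\<longrightarrow> Contact b a)"
| "contact_axiom e ((a \<^bold>\<noteq> TZero e) \<^bold>\<longrightarrow> Contact a a)"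
| "contact_axiom e ((a \<^bold>\<noteq> TZero e) \<^bold>\<longrightarrow> ((a \<^bold>\<noteq> TOne e) \<^bold>\<longrightarrow> Contact a (\<^bold>- a)))"

inductive F_theorem :: "trm \<Rightarrow> fm \<Rightarrow> bool" for e where
  prop_ax: "prop_axiom A \<Longrightarrow> F_theorem e A"
| eq_ax: "eq_axiom A \<Longrightarrow> F_theorem e A"
| boolean_ax: "boolean_axiom e A \<Longrightarrow> F_theorem e A"
| contact_ax: "contact_axiom e A \<Longrightarrow> F_theorem e A"
| modus_ponens: "F_theorem e A \<Longrightarrow> F_theorem e (A \<^bold>\<longrightarrow> B) \<Longrightarrow> F_theorem e B"

end

theory Submission
  imports Defs
begin

text \<open>Suppose \<open>\<phi>\<close> is not derivable. Then \<open>\<phi>\<close> is missing from some complete theory \<open>T\<close>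
  (\<open>complete_theory_omitting\<close>), and it suffices to refute \<open>\<phi>\<close> by polytopes.

  Modulo \<open>T\<close> the terms form a Boolean algebra with a contact relation. Only the finitely many
  variables of \<open>\<phi>\<close> and \<open>e\<close> matter, and the subalgebra that they generate is finite, hence isomorphic
  to the algebra of all sets of its atoms. As contact distributes over joins, it is determined by
  the contacts between atoms. So \<open>T\<close> is described, as far as these variables go, by a finite
  reflexive symmetric graph of atoms (\<open>mem_iff_holds_frame\<close>). The axiom that \<open>a\<close> touches \<open>-a\<close> unless
  one of them is zero says that this graph is connected (\<open>worlds_connected\<close>).

  A finite connected graph can be realised in \<open>\<real>\<^sup>n\<close> for every positive \<open>n\<close>, even for \<open>n = 1\<close>,
  because regions need not be connected: take a walk that runs through all edges
  (\<open>walk_through_edges\<close>), cut the space into as many parallel slabs as the walk has vertices, and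
  let an atom occupy the slabs at which the walk visits it. Neighbouring slabs touch and others do
  not, so two atoms touch exactly if they are joined by an edge. This embeds the algebra of sets of
  atoms into the polytopes (\<open>frame_true_if_polytopes_true\<close>), and the formulas true under the
  canonical valuation are those in \<open>T\<close>.\<close>

section \<open>Complete theories\<close>

text \<open>Complete theories are presented by the clauses for the connectives, so that every axiom
  can be read as a property of the relations that the theory induces on terms.\<close>

locale complete_theory =
  fixes e :: trm and T :: "fm set"
  assumes F_theorem_mem: "F_theorem e A \<Longrightarrow> A \<in> T"
    and FNot_mem [simp]: "(\<^bold>\<not> A) \<in> T \<longleftrightarrow> A \<notin> T"
    and FOr_mem [simp]: "(A \<^bold>\<or> B) \<in> T \<longleftrightarrow> A \<in> T \<or> B \<in> T"

text \<open>A maximal set among those that contain the theorems, are closed under modus ponens and omit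
  \<open>\<phi>\<close> is complete. Adding \<open>B\<close> to such a set \<open>T\<close> yields \<open>{A. (B \<^bold>\<longrightarrow> A) \<in> T}\<close>, which the first two
  propositional schemes show to be closed again; so \<open>B \<notin> T\<close> forces \<open>(B \<^bold>\<longrightarrow> \<phi>) \<in> T\<close>, and the clauses
  for the connectives follow by arguing with \<open>\<phi>\<close> in the role of falsity.\<close>

lemma complete_theory_omitting:
  assumes "\<not> F_theorem e \<phi>"
  obtains T where "complete_theory e T" "\<phi> \<notin> T"
proof -
  define closed where "closed T \<longleftrightarrow> Collect (F_theorem e) \<subseteq> T \<and>
    (\<forall>A B. A \<in> T \<longrightarrow> (A \<^bold>\<longrightarrow> B) \<in> T \<longrightarrow> B \<in> T)" for T
  let ?\<T> = "{T. closed T \<and> \<phi> \<notin> T}"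
  have "\<exists>T\<in>?\<T>. \<forall>X\<in>?\<T>. T \<subseteq> X \<longrightarrow> X = T"
  proof (rule subset_Zorn_nonempty)
    have "Collect (F_theorem e) \<in> ?\<T>"
      using assms by (auto simp: closed_def elim: modus_ponens)
    then show "?\<T> \<noteq> {}" by blast
  next
    fix \<C> assume \<C>: "\<C> \<noteq> {}" "subset.chain ?\<T> \<C>"
    then have sub: "\<And>X. X \<in> \<C> \<Longrightarrow> closed X \<and> \<phi> \<notin> X"
      and lin: "\<And>X Y. X \<in> \<C> \<Longrightarrow> Y \<in> \<C> \<Longrightarrow> X \<subseteq> Y \<or> Y \<subseteq> X"
      by (auto simp: subset_chain_def)
    have "closed (\<Union>\<C>)"
      unfolding closed_def
    proof (intro conjI allI impI)
      show "Collect (F_theorem e) \<subseteq> \<Union>\<C>"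
        using \<C>(1) sub unfolding closed_def by blast
      fix A B assume "A \<in> \<Union>\<C>" "(A \<^bold>\<longrightarrow> B) \<in> \<Union>\<C>"
      then obtain X Y where "X \<in> \<C>" "A \<in> X" "Y \<in> \<C>" "(A \<^bold>\<longrightarrow> B) \<in> Y" by blast
      with lin obtain Z where "Z \<in> \<C>" "A \<in> Z" "(A \<^bold>\<longrightarrow> B) \<in> Z" by blast
      with sub show "B \<in> \<Union>\<C>" unfolding closed_def by blast
    qed
    with sub show "\<Union>\<C> \<in> ?\<T>" by blast
  qed
  then obtain T where cl: "closed T" and no: "\<phi> \<notin> T"
    and max: "\<And>X. closed X \<Longrightarrow> \<phi> \<notin> X \<Longrightarrow> T \<subseteq> X \<Longrightarrow> X = T" by auto
  have theorem_mem: "F_theorem e A \<Longrightarrow> A \<in> T" for A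
    using cl unfolding closed_def by blast
  have mp: "(A \<^bold>\<longrightarrow> B) \<in> T \<Longrightarrow> A \<in> T \<Longrightarrow> B \<in> T" for A B
    using cl unfolding closed_def by blast
  note ax = theorem_mem[OF prop_ax]
  have ref: "(B \<^bold>\<longrightarrow> \<phi>) \<in> T" if "B \<notin> T" for B
  proof (rule ccontr)
    assume no': "(B \<^bold>\<longrightarrow> \<phi>) \<notin> T"
    let ?X = "{A. (B \<^bold>\<longrightarrow> A) \<in> T}"
    have weaken: "T \<subseteq> ?X" by (auto intro: mp[OF ax[OF prop_axiom.intros(1)]])
    have "closed ?X"
      unfolding closed_def
    proof (intro conjI allI impI)
      show "Collect (F_theorem e) \<subseteq> ?X" using weaken theorem_mem by blast
      fix A D assume "A \<in> ?X" "(A \<^bold>\<longrightarrow> D) \<in> ?X"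
      then show "D \<in> ?X" using mp[OF mp[OF ax[OF prop_axiom.intros(2)]], of B A D] by simp
    qed
    then have "?X = T" using max no' weaken by blast
    moreover have "(B \<^bold>\<longrightarrow> B) \<in> T"
      by (rule mp[OF mp[OF ax[OF prop_axiom.intros(2)] ax[OF prop_axiom.intros(1)]]
            ax[OF prop_axiom.intros(1)[of B B]]])
    ultimately have "B \<in> T" by auto
    with that show False by simp
  qed
  have disj: "(A \<^bold>\<or> B) \<in> T \<longleftrightarrow> A \<in> T \<or> B \<in> T" for A B
  proof
    assume "(A \<^bold>\<or> B) \<in> T"
    then show "A \<in> T \<or> B \<in> T"
      using mp[OF mp[OF mp[OF ax[OF prop_axiom.intros(5)]]], of A \<phi> B] ref[of A] ref[of B] no by blast
  next
    assume "A \<in> T \<or> B \<in> T"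
    then show "(A \<^bold>\<or> B) \<in> T"
      using mp[OF ax[OF prop_axiom.intros(3)[of A B]]] mp[OF ax[OF prop_axiom.intros(4)[of B A]]]
      by blast
  qed
  have neg: "(\<^bold>\<not> A) \<in> T \<longleftrightarrow> A \<notin> T" for A
  proof
    assume "(\<^bold>\<not> A) \<in> T"
    then have "(A \<^bold>\<longrightarrow> \<phi>) \<in> T" using disj[of "\<^bold>\<not> A"] by simp
    with mp[of A \<phi>] no show "A \<notin> T" by blast
  next
    assume "A \<notin> T"
    moreover have "(A \<^bold>\<longrightarrow> A) \<in> T"
      by (rule mp[OF mp[OF ax[OF prop_axiom.intros(2)] ax[OF prop_axiom.intros(1)]]
            ax[OF prop_axiom.intros(1)[of A A]]])
    ultimately show "(\<^bold>\<not> A) \<in> T" using disj[of "\<^bold>\<not> A" A] by simp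
  qed
  have "complete_theory e T"
    by standard (rule theorem_mem neg disj, assumption?)+
  with no that show thesis by blast
qed

section \<open>Terms modulo a complete theory\<close>

primrec trm_vars :: "trm \<Rightarrow> nat set" where
  "trm_vars (Var i) = {i}"
| "trm_vars (\<^bold>- a) = trm_vars a"
| "trm_vars (a \<^bold>+ b) = trm_vars a \<union> trm_vars b"

primrec fm_vars :: "fm \<Rightarrow> nat set" where
  "fm_vars (a \<^bold>\<equiv> b) = trm_vars a \<union> trm_vars b"
| "fm_vars (Contact a b) = trm_vars a \<union> trm_vars b"
| "fm_vars (\<^bold>\<not> A) = fm_vars A"
| "fm_vars (A \<^bold>\<or> B) = fm_vars A \<union> fm_vars B"

lemma finite_trm_vars: "finite (trm_vars a)"
  by (induction a) auto

lemma finite_fm_vars: "finite (fm_vars A)"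
  by (induction A) (auto simp: finite_trm_vars)

text \<open>A two-valued valuation is represented by the set of variables that it makes true, so that
  the valuations of finitely many variables form a finite set.\<close>

primrec sat :: "nat set \<Rightarrow> trm \<Rightarrow> bool" where
  "sat s (Var i) \<longleftrightarrow> i \<in> s"
| "sat s (\<^bold>- a) \<longleftrightarrow> \<not> sat s a"
| "sat s (a \<^bold>+ b) \<longleftrightarrow> sat s a \<or> sat s b"

definition lit :: "nat set \<Rightarrow> nat \<Rightarrow> trm" where
  "lit s i = (if i \<in> s then Var i else \<^bold>- Var i)"

text \<open>The part of \<open>a\<close> on which the variables in the list are decided as in \<open>s\<close>. Starting the
  product with \<open>a\<close> lets one induction on the list serve every \<open>a\<close>.\<close>

primrec cell :: "trm \<Rightarrow> nat list \<Rightarrow> nat set \<Rightarrow> trm" where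
  "cell a [] s = a"
| "cell a (i # vs) s = cell (a \<^bold>* lit s i) vs s"

lemma cell_cong: "(\<And>i. i \<in> set vs \<Longrightarrow> i \<in> s \<longleftrightarrow> i \<in> t) \<Longrightarrow> cell a vs s = cell a vs t"
proof (induction vs arbitrary: a)
  case (Cons i vs)
  have "lit s i = lit t i" using Cons.prems[of i] by (simp add: lit_def)
  moreover have "cell b vs s = cell b vs t" for b
    by (rule Cons.IH, rule Cons.prems) simp
  ultimately show ?case by simp
qed simp

lemma sat_lit: "sat s (lit t i) \<longleftrightarrow> (i \<in> s \<longleftrightarrow> i \<in> t)"
  by (simp add: lit_def)

lemma sat_cell: "sat s (cell a vs t) \<longleftrightarrow> sat s a \<and> (\<forall>i\<in>set vs. i \<in> s \<longleftrightarrow> i \<in> t)"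
proof (induction vs arbitrary: a)
  case (Cons i vs)
  have "sat s (a \<^bold>* lit t i) \<longleftrightarrow> sat s a \<and> (i \<in> s \<longleftrightarrow> i \<in> t)" by (simp add: sat_lit)
  then show ?case by (simp only: cell.simps Cons.IH) auto
qed simp

lemma trm_vars_cell: "trm_vars (cell a vs t) = trm_vars a \<union> set vs"
  by (induction vs arbitrary: a) (auto simp: lit_def)

text \<open>Every set of valuations of finitely many variables is defined by a term, its disjunctive
  normal form. The empty disjunction is the constant zero, which brings in the variables of \<open>e\<close>.\<close>

lemma term_defining:
  assumes "finite U" "U \<subseteq> Pow (set vs)" "trm_vars e \<subseteq> set vs"
  obtains a where "trm_vars a \<subseteq> set vs" "\<forall>s\<subseteq>set vs. sat s a \<longleftrightarrow> s \<in> U"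
proof -
  have "\<exists>a. trm_vars a \<subseteq> set vs \<and> (\<forall>s. s \<subseteq> set vs \<longrightarrow> (sat s a \<longleftrightarrow> s \<in> U))"
    using assms(1,2)
  proof (induction U rule: finite_induct)
    case empty
    show ?case using assms(3) by (intro exI[of _ "TZero e"]) auto
  next
    case (insert t U)
    then obtain a where "trm_vars a \<subseteq> set vs" "\<forall>s. s \<subseteq> set vs \<longrightarrow> (sat s a \<longleftrightarrow> s \<in> U)"
      by auto
    moreover have "(\<forall>i\<in>set vs. i \<in> s \<longleftrightarrow> i \<in> t) \<longleftrightarrow> s = t" if "s \<subseteq> set vs" for s
      using that insert.prems by blast
    ultimately show ?case using assms(3)
      by (intro exI[of _ "cell (TOne e) vs t \<^bold>+ a"]) (simp add: sat_cell trm_vars_cell)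
  qed
  with that show thesis by blast
qed

context complete_theory
begin

definition eqv :: "trm \<Rightarrow> trm \<Rightarrow> bool" (infix \<open>\<doteq>\<close> 50) where
  "a \<doteq> b \<longleftrightarrow> (a \<^bold>\<equiv> b) \<in> T"

definition le :: "trm \<Rightarrow> trm \<Rightarrow> bool" (infix \<open>\<preceq>\<close> 50) where
  "a \<preceq> b \<longleftrightarrow> a \<^bold>* b \<doteq> a"

definition ct :: "trm \<Rightarrow> trm \<Rightarrow> bool" where
  "ct a b \<longleftrightarrow> Contact a b \<in> T"

lemma eqv_refl [simp]: "a \<doteq> a"
  using F_theorem_mem[OF eq_ax[OF eq_axiom.intros(1)]] by (simp add: eqv_def)

lemma eqv_sym: "a \<doteq> b \<Longrightarrow> b \<doteq> a"
  using F_theorem_mem[OF eq_ax[OF eq_axiom.intros(2)]] by (simp add: eqv_def)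

lemma eqv_trans [trans]: "a \<doteq> b \<Longrightarrow> b \<doteq> c \<Longrightarrow> a \<doteq> c"
  using F_theorem_mem[OF eq_ax[OF eq_axiom.intros(3)]] by (simp add: eqv_def)

lemma neg_cong: "a \<doteq> b \<Longrightarrow> (\<^bold>- a) \<doteq> (\<^bold>- b)"
  using F_theorem_mem[OF eq_ax[OF eq_axiom.intros(4)]] by (simp add: eqv_def)

lemma join_cong: "a \<doteq> b \<Longrightarrow> c \<doteq> d \<Longrightarrow> a \<^bold>+ c \<doteq> b \<^bold>+ d"
  using F_theorem_mem[OF eq_ax[OF eq_axiom.intros(5)]] by (simp add: eqv_def)

lemma meet_cong: "a \<doteq> b \<Longrightarrow> c \<doteq> d \<Longrightarrow> a \<^bold>* c \<doteq> b \<^bold>* d"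
  by (intro neg_cong join_cong)

lemma ct_cong: "a \<doteq> b \<Longrightarrow> c \<doteq> d \<Longrightarrow> ct a c \<Longrightarrow> ct b d"
  using F_theorem_mem[OF eq_ax[OF eq_axiom.intros(6)]] by (simp add: eqv_def ct_def)

lemmas boolean_mem = F_theorem_mem[OF boolean_ax]

lemma meet_assoc: "a \<^bold>* (b \<^bold>* c) \<doteq> a \<^bold>* b \<^bold>* c"
  and join_commute: "a \<^bold>+ b \<doteq> b \<^bold>+ a"
  and meet_commute: "a \<^bold>* b \<doteq> b \<^bold>* a"
  and join_absorb: "a \<^bold>+ a \<^bold>* b \<doteq> a"
  and meet_absorb: "a \<^bold>* (a \<^bold>+ b) \<doteq> a"
  and meet_distrib: "a \<^bold>* (b \<^bold>+ c) \<doteq> a \<^bold>* b \<^bold>+ a \<^bold>* c"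
  and join_compl: "a \<^bold>+ (\<^bold>- a) \<doteq> TOne e"
  and meet_compl: "a \<^bold>* (\<^bold>- a) \<doteq> TZero e"
  and zero_neq_one: "\<not> TZero e \<doteq> TOne e"
  using boolean_mem[OF boolean_axiom.intros(2)] boolean_mem[OF boolean_axiom.intros(3)]
    boolean_mem[OF boolean_axiom.intros(4)] boolean_mem[OF boolean_axiom.intros(5)]
    boolean_mem[OF boolean_axiom.intros(6)] boolean_mem[OF boolean_axiom.intros(7)]
    boolean_mem[OF boolean_axiom.intros(9)] boolean_mem[OF boolean_axiom.intros(10)]
    boolean_mem[OF boolean_axiom.intros(11)]
  by (simp_all add: eqv_def)

lemmas contact_mem = F_theorem_mem[OF contact_ax]

lemma not_ct_zero: "\<not> ct (TZero e) a"
  and ct_join: "ct a (b \<^bold>+ c) \<longleftrightarrow> ct a b \<or> ct a c"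
  and ct_sym: "ct a b \<Longrightarrow> ct b a"
  and ct_refl: "\<not> a \<doteq> TZero e \<Longrightarrow> ct a a"
  and ct_compl: "\<not> a \<doteq> TZero e \<Longrightarrow> \<not> a \<doteq> TOne e \<Longrightarrow> ct a (\<^bold>- a)"
  using contact_mem[OF contact_axiom.intros(1), of a]
    contact_mem[OF contact_axiom.intros(2), of a b c]
    contact_mem[OF contact_axiom.intros(3), of a b]
    contact_mem[OF contact_axiom.intros(4), of a]
    contact_mem[OF contact_axiom.intros(5), of a]
  by (auto simp add: eqv_def ct_def)

lemma meet_idem: "a \<^bold>* a \<doteq> a"
  by (rule eqv_trans[OF meet_cong[OF eqv_refl eqv_sym[OF join_absorb]] meet_absorb])

lemma join_zero: "a \<^bold>+ TZero e \<doteq> a"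
  by (rule eqv_trans[OF join_cong[OF eqv_refl eqv_sym[OF meet_compl]] join_absorb])

lemma meet_one: "a \<^bold>* TOne e \<doteq> a"
  by (rule eqv_trans[OF meet_cong[OF eqv_refl eqv_sym[OF join_compl]] meet_absorb])

lemma meet_zero: "a \<^bold>* TZero e \<doteq> TZero e"
proof -
  have "a \<^bold>* TZero e \<doteq> a \<^bold>* (a \<^bold>* (\<^bold>- a))" by (intro meet_cong eqv_refl eqv_sym[OF meet_compl])
  also have "\<dots> \<doteq> a \<^bold>* a \<^bold>* (\<^bold>- a)" by (rule meet_assoc)
  also have "\<dots> \<doteq> a \<^bold>* (\<^bold>- a)" by (intro meet_cong eqv_refl meet_idem)
  also have "\<dots> \<doteq> TZero e" by (rule meet_compl)
  finally show ?thesis .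
qed

lemma split_by: "a \<^bold>* b \<^bold>+ a \<^bold>* (\<^bold>- b) \<doteq> a"
proof -
  have "a \<^bold>* b \<^bold>+ a \<^bold>* (\<^bold>- b) \<doteq> a \<^bold>* (b \<^bold>+ (\<^bold>- b))" by (rule eqv_sym[OF meet_distrib])
  also have "\<dots> \<doteq> a \<^bold>* TOne e" by (intro meet_cong eqv_refl join_compl)
  also have "\<dots> \<doteq> a" by (rule meet_one)
  finally show ?thesis .
qed

lemma le_trans [trans]:
  assumes "a \<preceq> b" "b \<preceq> c"
  shows "a \<preceq> c"
proof -
  have "a \<^bold>* c \<doteq> a \<^bold>* b \<^bold>* c" 
    by (intro meet_cong eqv_refl) (rule eqv_sym[OF assms(1)[unfolded le_def]])
  also have "\<dots> \<doteq> a \<^bold>* (b \<^bold>* c)" by (rule eqv_sym[OF meet_assoc])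
  also have "\<dots> \<doteq> a \<^bold>* b" using assms by (intro meet_cong eqv_refl) (auto simp: le_def)
  also have "\<dots> \<doteq> a" using assms by (simp add: le_def)
  finally show ?thesis by (simp add: le_def)
qed

lemma le_antisym: "a \<preceq> b \<Longrightarrow> b \<preceq> a \<Longrightarrow> a \<doteq> b"
  unfolding le_def by (rule eqv_trans[OF eqv_sym eqv_trans[OF meet_commute]])

lemma eqv_imp_le: "a \<doteq> b \<Longrightarrow> a \<preceq> b"
  unfolding le_def by (rule eqv_trans[OF meet_cong[OF eqv_refl eqv_sym] meet_idem])

lemma meet_le2: "a \<^bold>* b \<preceq> b"
  unfolding le_def
  by (rule eqv_trans[OF eqv_sym[OF meet_assoc] meet_cong[OF eqv_refl meet_idem]])

lemma meet_le1: "a \<^bold>* b \<preceq> a"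
  by (rule le_trans[OF eqv_imp_le[OF meet_commute] meet_le2])

lemma le_meet:
  assumes "c \<preceq> a" "c \<preceq> b"
  shows "c \<preceq> a \<^bold>* b"
proof -
  have "c \<^bold>* (a \<^bold>* b) \<doteq> c \<^bold>* a \<^bold>* b" by (rule meet_assoc)
  also have "\<dots> \<doteq> c \<^bold>* b" using assms by (intro meet_cong eqv_refl) (simp add: le_def)
  also have "\<dots> \<doteq> c" using assms by (simp add: le_def)
  finally show ?thesis by (simp add: le_def)
qed

lemma le_join1: "a \<preceq> a \<^bold>+ b"
  unfolding le_def by (rule meet_absorb)

lemma le_join2: "b \<preceq> a \<^bold>+ b"
  by (rule le_trans[OF le_join1 eqv_imp_le[OF join_commute]])

lemma le_one: "a \<preceq> TOne e"
  unfolding le_def by (rule meet_one)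

lemma le_zero_iff: "a \<preceq> TZero e \<longleftrightarrow> a \<doteq> TZero e"
proof
  assume "a \<preceq> TZero e"
  then show "a \<doteq> TZero e" unfolding le_def by (rule eqv_trans[OF eqv_sym meet_zero])
qed (rule eqv_imp_le)

lemma disjoint_if_le_compl:
  assumes "a \<preceq> b" "a \<preceq> \<^bold>- b"
  shows "a \<doteq> TZero e"
  using le_trans[OF le_meet[OF assms] eqv_imp_le[OF meet_compl]] by (simp add: le_zero_iff)

lemma le_if_diff_zero:
  assumes "a \<^bold>* (\<^bold>- b) \<doteq> TZero e"
  shows "a \<preceq> b"
proof -
  have "a \<^bold>* b \<doteq> a \<^bold>* b \<^bold>+ TZero e" by (rule eqv_sym[OF join_zero])
  also have "\<dots> \<doteq> a \<^bold>* b \<^bold>+ a \<^bold>* (\<^bold>- b)" by (intro join_cong eqv_refl eqv_sym[OF assms])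
  also have "\<dots> \<doteq> a" by (rule split_by)
  finally show ?thesis by (simp add: le_def)
qed

lemma le_compl_if_disjoint:
  assumes "a \<^bold>* b \<doteq> TZero e"
  shows "a \<preceq> \<^bold>- b"
proof -
  have "a \<^bold>* (\<^bold>- b) \<doteq> a \<^bold>* (\<^bold>- b) \<^bold>+ TZero e" by (rule eqv_sym[OF join_zero])
  also have "\<dots> \<doteq> a \<^bold>* (\<^bold>- b) \<^bold>+ a \<^bold>* b" by (intro join_cong eqv_refl eqv_sym[OF assms])
  also have "\<dots> \<doteq> a \<^bold>* b \<^bold>+ a \<^bold>* (\<^bold>- b)" by (rule join_commute)
  also have "\<dots> \<doteq> a" by (rule split_by)
  finally show ?thesis by (simp add: le_def)
qed

lemma disjoint_if_le_neg:
  assumes "a \<preceq> \<^bold>- b"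
  shows "a \<^bold>* b \<doteq> TZero e"
  by (rule disjoint_if_le_compl[OF meet_le2 le_trans[OF meet_le1 assms]])

lemma ct_mono:
  assumes "ct a b" "a \<preceq> a'" "b \<preceq> b'"
  shows "ct a' b'"
proof -
  have right: "ct c d'" if "ct c d" "d \<preceq> d'" for c d d'
  proof -
    have "d' \<^bold>+ d \<doteq> d' \<^bold>+ d \<^bold>* d'" by (intro join_cong eqv_refl) (rule eqv_sym[OF that(2)[unfolded le_def]])
    also have "\<dots> \<doteq> d' \<^bold>+ d' \<^bold>* d" by (intro join_cong eqv_refl meet_commute)
    also have "\<dots> \<doteq> d'" by (rule join_absorb)
    finally show ?thesis by (rule ct_cong[OF eqv_refl]) (simp add: ct_join that(1))
  qed
  have "ct b a'" by (rule right[OF ct_sym[OF assms(1)] assms(2)])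
  then show ?thesis by (rule right[OF ct_sym assms(3)])
qed

lemma ct_split:
  assumes "ct a b"
  shows "ct (a \<^bold>* x) b \<or> ct (a \<^bold>* (\<^bold>- x)) b"
proof -
  have "ct b (a \<^bold>* x \<^bold>+ a \<^bold>* (\<^bold>- x))"
    by (rule ct_cong[OF eqv_refl eqv_sym[OF split_by] ct_sym[OF assms]])
  then show ?thesis by (auto simp: ct_join intro: ct_sym)
qed

lemma nonzero_split:
  assumes "\<not> a \<doteq> TZero e"
  shows "\<not> a \<^bold>* x \<doteq> TZero e \<or> \<not> a \<^bold>* (\<^bold>- x) \<doteq> TZero e"
proof (rule ccontr)
  assume "\<not> ?thesis"
  then have "a \<preceq> x" "a \<preceq> \<^bold>- x"
    using le_if_diff_zero le_compl_if_disjoint by simp_all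
  with assms disjoint_if_le_compl show False by blast
qed

lemma not_ct_null: "a \<doteq> TZero e \<Longrightarrow> \<not> ct a b"
  using not_ct_zero[of b] by (auto dest: ct_cong[OF _ eqv_refl])

text \<open>Deciding the variables of a term decides the term: \<open>m\<close> need not be a product of literals, it
  only has to lie below one literal of every variable concerned.\<close>

lemma decides:
  assumes "\<And>i. i \<in> trm_vars a \<Longrightarrow> m \<preceq> lit s i"
  shows "m \<preceq> (if sat s a then a else \<^bold>- a)"
  using assms
proof (induction a)
  case (Var i)
  then show ?case by (auto simp: lit_def split: if_splits)
next
  case (TNeg a)
  have "a \<preceq> \<^bold>- (\<^bold>- a)" by (rule le_compl_if_disjoint[OF meet_compl])
  with TNeg show ?case by (auto split: if_splits elim: le_trans)
next
  case (TJoin a b)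
  show ?case
  proof (cases "sat s (a \<^bold>+ b)")
    case True
    then consider "sat s a" | "sat s b" by auto
    then have "m \<preceq> a \<^bold>+ b"
      using TJoin by cases (auto intro: le_trans[OF _ le_join1] le_trans[OF _ le_join2])
    with True show ?thesis by simp
  next
    case False
    with TJoin have "m \<preceq> \<^bold>- a" "m \<preceq> \<^bold>- b" by auto
    then have "m \<^bold>* a \<^bold>+ m \<^bold>* b \<doteq> TZero e \<^bold>+ TZero e"
      by (intro join_cong disjoint_if_le_neg)
    then have "m \<^bold>* (a \<^bold>+ b) \<doteq> TZero e"
      by (rule eqv_trans[OF meet_distrib eqv_trans[OF _ join_zero]])
    with False show ?thesis by (simp add: le_compl_if_disjoint)
  qed
qed

lemma cell_mono: "a \<preceq> b \<Longrightarrow> cell a vs s \<preceq> cell b vs s"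
proof (induction vs arbitrary: a b)
  case (Cons i vs)
  then have "a \<^bold>* lit s i \<preceq> b \<^bold>* lit s i" by (intro le_meet meet_le2 le_trans[OF meet_le1])
  then show ?case by (simp add: Cons.IH)
qed auto

lemma cell_le: "cell a vs s \<preceq> a"
proof (induction vs arbitrary: a)
  case (Cons i vs)
  show ?case using le_trans[OF Cons.IH meet_le1] by simp
qed (simp add: eqv_imp_le)

lemma cell_le_lit: "i \<in> set vs \<Longrightarrow> cell a vs s \<preceq> lit s i"
proof (induction vs arbitrary: a)
  case (Cons j vs)
  then show ?case using le_trans[OF cell_le meet_le2] by (cases "i = j") simp_all
qed simp

text \<open>A property that passes to one of the two parts of any splitting passes to some cell. Both
  being nonzero and being in contact with a given term are of this kind.\<close>

lemma pass_to_cell: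
  assumes "Q a" "distinct vs"
    and "\<And>b x. Q b \<Longrightarrow> Q (b \<^bold>* x) \<or> Q (b \<^bold>* (\<^bold>- x))"
  obtains s where "s \<subseteq> set vs" "Q (cell a vs s)"
proof -
  have "\<exists>s\<subseteq>set vs. Q (cell a vs s)"
    using assms(1,2)
  proof (induction vs arbitrary: a)
    case (Cons i vs)
    \<comment> \<open>As the list has no repetitions, the choice \<open>y\<close> for \<open>i\<close> cannot clash with the set \<open>s\<close>
      chosen for the remaining variables, and the two can be united.\<close>
    obtain y where y: "y = {} \<or> y = {i}" "Q (a \<^bold>* lit y i)"
      using assms(3)[OF Cons.prems(1), of "Var i"] unfolding lit_def
      by (metis empty_iff singletonI)
    then obtain s where s: "s \<subseteq> set vs" "Q (cell (a \<^bold>* lit y i) vs s)"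
      using Cons by auto
    have "cell (a \<^bold>* lit y i) vs s = cell a (i # vs) (s \<union> y)"
      using Cons.prems(2) s(1) y(1) by (auto simp: lit_def intro!: cell_cong)
    with s y(1) show ?case by (intro exI[of _ "s \<union> y"]) auto
  qed auto
  with that show thesis by blast
qed

end

section \<open>Finite contact frames and walks\<close>

text \<open>This is the discrete contact algebra of the adjacency space \<open>(W, R)\<close>.\<close>

definition frame_structure :: "'w set \<Rightarrow> ('w \<Rightarrow> 'w \<Rightarrow> bool) \<Rightarrow> 'w set contact_structure" where
  "frame_structure W R =
     \<lparr> carr = Pow W,
       compl = (\<lambda>U. W - U),
       join = (\<union>),
       contact = (\<lambda>U V. \<exists>s\<in>U. \<exists>t\<in>V. R s t) \<rparr>"

text \<open>An embedding has to reflect equality, hence be injective, since formulas may negate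
  equations.\<close>

lemma holds_embedding:
  assumes closed: "\<And>U. U \<in> carr M \<Longrightarrow> compl M U \<in> carr M"
      "\<And>U V. U \<in> carr M \<Longrightarrow> V \<in> carr M \<Longrightarrow> join M U V \<in> carr M"
    and hom: "\<And>U. U \<in> carr M \<Longrightarrow> h (compl M U) = compl N (h U)"
      "\<And>U V. U \<in> carr M \<Longrightarrow> V \<in> carr M \<Longrightarrow> h (join M U V) = join N (h U) (h V)"
      "\<And>U V. U \<in> carr M \<Longrightarrow> V \<in> carr M \<Longrightarrow> contact M U V \<longleftrightarrow> contact N (h U) (h V)"
    and inj: "inj_on h (carr M)"
    and v: "\<And>i. v i \<in> carr M"
  shows "holds N (\<lambda>i. h (v i)) A \<longleftrightarrow> holds M v A"
proof -
  have mem: "tval M v a \<in> carr M" for a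
    by (induction a) (simp_all add: closed v)
  have "tval N (\<lambda>i. h (v i)) a = h (tval M v a)" for a
    by (induction a) (simp_all add: hom mem)
  then show ?thesis
    by (induction A) (simp_all add: hom mem inj_on_eq_iff[OF inj])
qed

text \<open>Some walk in a finite connected graph runs through every edge: having reached \<open>u\<close>, it can
  always be prolonged to the beginning of the next edge on the list.\<close>

lemma walk_through_edges:
  fixes W :: "'w set"
  assumes "finite E" "E \<subseteq> W \<times> W" "W \<noteq> {}"
    and connected: "\<And>s t. s \<in> W \<Longrightarrow> t \<in> W \<Longrightarrow> (s, t) \<in> E\<^sup>*"
  obtains xs where "xs \<noteq> []" "set xs \<subseteq> W" "successively (\<lambda>s t. (s, t) \<in> E) xs"
    "\<And>s t. (s, t) \<in> E \<Longrightarrow> \<exists>ys zs. xs = ys @ s # t # zs"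
proof -
  define walk where
    "walk xs \<longleftrightarrow> xs \<noteq> [] \<and> set xs \<subseteq> W \<and> successively (\<lambda>s t. (s, t) \<in> E) xs" for xs
  have extend: "walk (xs @ [t])" if "walk xs" "(last xs, t) \<in> E" for xs t
    using that assms(2) unfolding walk_def by (simp add: successively_append_iff) blast
  have reach: "\<exists>ps. walk (xs @ ps) \<and> last (xs @ ps) = t" if "walk xs" "(last xs, t) \<in> E\<^sup>*" for xs t
    using that(2)
  proof (induction rule: rtrancl_induct)
    case base
    show ?case using that(1) by (intro exI[of _ "[]"]) simp
  next
    case (step t t')
    then obtain ps where "walk (xs @ ps)" "last (xs @ ps) = t" by blast
    with step.hyps(2) have "walk ((xs @ ps) @ [t'])" by (intro extend) simp_all
    then show ?case by (intro exI[of _ "ps @ [t']"]) simp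
  qed
  define passes where "passes xs p \<longleftrightarrow> (\<exists>ys zs. xs = ys @ fst p # snd p # zs)"
    for xs :: "'w list" and p
  have passes_append: "passes (xs @ ps) p" if "passes xs p" for xs ps p
    using that unfolding passes_def by (metis append_assoc append_Cons)
  have "\<exists>xs. walk xs \<and> (\<forall>p\<in>F. passes xs p)" if "finite F" "F \<subseteq> E" for F
    using that
  proof (induction F rule: finite_induct)
    case empty
    obtain w where "w \<in> W" using assms(3) by blast
    then show ?case by (intro exI[of _ "[w]"]) (simp add: walk_def)
  next
    case (insert f F)
    obtain s t where f: "f = (s, t)" by (cases f)
    from insert obtain xs where xs: "walk xs" "\<forall>p\<in>F. passes xs p" by auto
    have st: "(s, t) \<in> E" using insert.prems f by simp
    have "last xs \<in> W" "s \<in> W"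
      using xs(1) st assms(2) last_in_set[of xs] unfolding walk_def by blast+
    then obtain ps where ps: "walk (xs @ ps)" "last (xs @ ps) = s"
      using reach[OF xs(1) connected] by blast
    have "walk ((xs @ ps) @ [t])" by (rule extend) (simp_all only: ps st)
    moreover have "passes ((xs @ ps) @ [t]) f"
    proof -
      have "xs @ ps = butlast (xs @ ps) @ [s]"
        using ps append_butlast_last_id[of "xs @ ps"] unfolding walk_def by simp
      then have "(xs @ ps) @ [t] = butlast (xs @ ps) @ s # t # []"
        by (metis append_assoc append_Cons append_Nil)
      then show ?thesis unfolding passes_def f fst_conv snd_conv by (intro exI)
    qed
    moreover have "passes ((xs @ ps) @ [t]) p" if "p \<in> F" for p
      by (intro passes_append bspec[OF xs(2) that])
    ultimately show ?case by (intro exI[of _ "(xs @ ps) @ [t]"]) simp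
  qed
  from this[OF assms(1) subset_refl] obtain xs where "walk xs" "\<forall>p\<in>E. passes xs p" by blast
  then show thesis
    by (intro that[of xs]) (simp_all add: walk_def passes_def split_beta Ball_def)
qed

section \<open>Slabs\<close>

text \<open>For \<open>i = 0, \<dots>, N\<close> these are consecutive parallel slabs orthogonal to \<open>b\<close>. Leaving the first and
  the last one unbounded on one side makes them cover the space.\<close>

definition slab :: "'a::euclidean_space \<Rightarrow> nat \<Rightarrow> nat \<Rightarrow> 'a set" where
  "slab b N i = {x. (i \<noteq> 0 \<longrightarrow> real i \<le> b \<bullet> x) \<and> (i \<noteq> N \<longrightarrow> b \<bullet> x \<le> real i + 1)}"

lemma slab_cover:
  obtains i where "i \<le> N" "x \<in> slab b N i"
proof
  show "min N (nat \<lfloor>b \<bullet> x\<rfloor>) \<le> N" by simp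
  have "b \<bullet> x < real_of_int (\<lfloor>b \<bullet> x\<rfloor>) + 1" "real_of_int (\<lfloor>b \<bullet> x\<rfloor>) \<le> b \<bullet> x" by linarith+
  then show "x \<in> slab b N (min N (nat \<lfloor>b \<bullet> x\<rfloor>))"
    unfolding slab_def min_def by auto linarith+
qed

text \<open>For \<open>N = 0\<close> the only slab is the whole space, which is not an intersection of half-spaces
  unless the empty family is admitted.\<close>

lemma slab_halfspaces:
  assumes "b \<noteq> 0" "i \<le> N" "0 < N"
  obtains H where "finite H" "H \<noteq> {}" "\<And>S. S \<in> H \<Longrightarrow> closed_halfspace S" "slab b N i = \<Inter>H"
proof
  let ?H = "(if i = 0 then {} else {{x. (- b) \<bullet> x \<le> - real i}})
    \<union> (if i = N then {} else {{x. b \<bullet> x \<le> real i + 1}})"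
  show "finite ?H" "?H \<noteq> {}" using assms by auto
  show "slab b N i = \<Inter>?H" by (auto simp: slab_def)
  show "closed_halfspace S" if "S \<in> ?H" for S
  proof -
    from that consider "S = {x. (- b) \<bullet> x \<le> - real i}" | "S = {x. b \<bullet> x \<le> real i + 1}"
      by (auto split: if_splits)
    then show ?thesis
    proof cases
      case 1
      with assms(1) show ?thesis
        unfolding closed_halfspace_def by (intro exI[of _ "- b"] exI[of _ "- real i"]) simp
    next
      case 2
      with assms(1) show ?thesis
        unfolding closed_halfspace_def by (intro exI[of _ b] exI[of _ "real i + 1"]) simp
    qed
  qed
qed

lemma interior_slab:
  assumes "b \<noteq> 0"
  shows "interior (slab b N i) =
    {x. (i \<noteq> 0 \<longrightarrow> real i < b \<bullet> x) \<and> (i \<noteq> N \<longrightarrow> b \<bullet> x < real i + 1)}"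
proof -
  have "slab b N i = (if i = 0 then UNIV else {x. b \<bullet> x \<ge> real i})
      \<inter> (if i = N then UNIV else {x. b \<bullet> x \<le> real i + 1})"
    by (auto simp: slab_def)
  then show ?thesis
    using assms by (auto simp: interior_halfspace_le interior_halfspace_ge)
qed

lemma interior_slab_nonempty:
  assumes "b \<noteq> 0"
  shows "interior (slab b N i) \<noteq> {}"
proof -
  have "((real i + 1 / 2) / (b \<bullet> b)) *\<^sub>R b \<in> interior (slab b N i)"
    unfolding interior_slab[OF assms] using assms by simp
  then show ?thesis by blast
qed

text \<open>A convex set with interior points is contained in the closure of its interior.\<close>

lemma closure_interior_slab:
  assumes "b \<noteq> 0"
  shows "closure (interior (slab b N i)) = slab b N i"
proof -
  have eq: "slab b N i = (if i = 0 then UNIV else {x. b \<bullet> x \<ge> real i})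
      \<inter> (if i = N then UNIV else {x. b \<bullet> x \<le> real i + 1})"
    by (auto simp: slab_def)
  have "convex (slab b N i)" "closed (slab b N i)"
    unfolding eq
    by (auto intro!: convex_Int closed_Int simp: convex_halfspace_le convex_halfspace_ge
        closed_halfspace_le closed_halfspace_ge)
  then show ?thesis
    using convex_closure_interior interior_slab_nonempty[OF assms] by (metis closure_closed)
qed

lemma slab_basic_polytope:
  assumes "b \<noteq> 0" "i \<le> N" "0 < N"
  shows "basic_polytope (slab b N i)"
  using slab_halfspaces[OF assms] closure_interior_slab[OF assms(1), of N i]
  unfolding basic_polytope_def by metis

lemma interior_slab_disjoint:
  assumes "b \<noteq> 0" "i \<le> N" "j \<le> N" "i \<noteq> j"
  shows "interior (slab b N i) \<inter> slab b N j = {}"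
proof -
  have "i \<noteq> N \<and> j \<noteq> 0 \<and> real i + 1 \<le> real j \<or> j \<noteq> N \<and> i \<noteq> 0 \<and> real j + 1 \<le> real i"
    using assms by auto
  then show ?thesis using assms(1) unfolding interior_slab[OF assms(1)] by (auto simp: slab_def)
qed

lemma slabs_touch_iff:
  assumes "b \<noteq> 0" "i \<le> N" "j \<le> N"
  shows "slab b N i \<inter> slab b N j \<noteq> {} \<longleftrightarrow> i \<le> Suc j \<and> j \<le> Suc i"
proof
  assume "slab b N i \<inter> slab b N j \<noteq> {}"
  then obtain x where x: "x \<in> slab b N i" "x \<in> slab b N j" by blast
  show "i \<le> Suc j \<and> j \<le> Suc i"
  proof (rule ccontr)
    assume "\<not> ?thesis"
    then consider "Suc j < i" | "Suc i < j" by linarith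
    then show False
      using x assms(2,3) by cases (auto simp: slab_def)
  qed
next
  assume "i \<le> Suc j \<and> j \<le> Suc i"
  then have "((real (max i j)) / (b \<bullet> b)) *\<^sub>R b \<in> slab b N i \<inter> slab b N j"
    using assms(1) by (auto simp: slab_def max_def)
  then show "slab b N i \<inter> slab b N j \<noteq> {}" by blast
qed

section \<open>Embedding a finite connected frame into the polytopes\<close>

text \<open>There is one slab for each entry of the walk \<open>xs\<close>, hence the last one, which is unbounded,
  has index \<open>length xs - 1\<close>.\<close>

definition region :: "'a::euclidean_space \<Rightarrow> 'w list \<Rightarrow> 'w set \<Rightarrow> 'a set" where
  "region b xs U = (\<Union>i\<in>{i. i < length xs \<and> xs ! i \<in> U}. slab b (length xs - 1) i)"

lemma region_Un: "region b xs (U \<union> V) = region b xs U \<union> region b xs V"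
  by (auto simp: region_def)

lemma region_polytope:
  assumes "b \<noteq> 0" "1 < length xs"
  shows "region b xs U \<in> polytopes"
proof -
  have "finite (slab b (length xs - 1) ` {i. i < length xs \<and> xs ! i \<in> U})" by simp
  moreover have "\<forall>B\<in>slab b (length xs - 1) ` {i. i < length xs \<and> xs ! i \<in> U}. basic_polytope B"
    using assms by (auto intro!: slab_basic_polytope)
  ultimately show ?thesis unfolding polytopes_def region_def by blast
qed

lemma interior_slab_region_disjoint:
  assumes "b \<noteq> 0" "i < length xs" "xs ! i \<notin> U"
  shows "interior (slab b (length xs - 1) i) \<inter> region b xs U = {}"
proof -
  have "interior (slab b (length xs - 1) i) \<inter> slab b (length xs - 1) j = {}"
    if "j < length xs" "xs ! j \<in> U" for j
    using assms that by (intro interior_slab_disjoint) auto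
  then show ?thesis unfolding region_def by blast
qed

text \<open>The slabs of the vertices outside \<open>U\<close> cover the complement of the region of \<open>U\<close>; conversely their interiors
  avoid that region, and each slab is the closure of its interior.\<close>

lemma region_compl:
  assumes "b \<noteq> 0" "xs \<noteq> []" "set xs \<subseteq> W"
  shows "region b xs (W - U) = closure (- region b xs U)"
proof
  have "slab b (length xs - 1) i \<subseteq> closure (- region b xs U)"
    if "i < length xs" "xs ! i \<notin> U" for i
    using closure_mono[of "interior (slab b (length xs - 1) i)" "- region b xs U"]
      interior_slab_region_disjoint[OF assms(1) that] closure_interior_slab[OF assms(1)]
    by blast
  then show "region b xs (W - U) \<subseteq> closure (- region b xs U)"
    unfolding region_def[of b xs "W - U"] by blast
next
  have "closed (slab b (length xs - 1) i)" for i
    using closure_interior_slab[OF assms(1)] closed_closure by metis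
  then have "closed (region b xs (W - U))"
    unfolding region_def by (intro closed_UN) auto
  moreover have "- region b xs U \<subseteq> region b xs (W - U)"
  proof
    fix x assume x: "x \<in> - region b xs U"
    obtain i where "i \<le> length xs - 1" "x \<in> slab b (length xs - 1) i" by (rule slab_cover)
    moreover from this have "i < length xs" using assms(2) by (cases xs) auto
    ultimately show "x \<in> region b xs (W - U)"
      using x assms(3) unfolding region_def by (auto dest: nth_mem)
  qed
  ultimately show "closure (- region b xs U) \<subseteq> region b xs (W - U)"
    by (rule closure_minimal[rotated])
qed

lemma region_mono_iff:
  assumes "b \<noteq> 0" "U \<subseteq> set xs"
  shows "region b xs U \<subseteq> region b xs V \<longleftrightarrow> U \<subseteq> V"
proof
  assume sub: "region b xs U \<subseteq> region b xs V"
  show "U \<subseteq> V"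
  proof (rule ccontr)
    assume "\<not> U \<subseteq> V"
    then obtain i where i: "i < length xs" "xs ! i \<in> U" "xs ! i \<notin> V"
      using assms(2) by (metis in_set_conv_nth subset_iff)
    then have "interior (slab b (length xs - 1) i) \<subseteq> region b xs U"
      using interior_subset unfolding region_def by blast
    then show False
      using sub interior_slab_region_disjoint[OF assms(1) i(1,3)]
        interior_slab_nonempty[OF assms(1), of "length xs - 1" i] by blast
  qed
qed (auto simp: region_def)

lemma region_contact:
  assumes "b \<noteq> 0"
  shows "region b xs U \<inter> region b xs V \<noteq> {} \<longleftrightarrow>
    (\<exists>i j. i < length xs \<and> j < length xs \<and> i \<le> Suc j \<and> j \<le> Suc i \<and> xs ! i \<in> U \<and> xs ! j \<in> V)"
proof -
  have touch: "slab b (length xs - 1) i \<inter> slab b (length xs - 1) j \<noteq> {} \<longleftrightarrow> i \<le> Suc j \<and> j \<le> Suc i"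
    if "i < length xs" "j < length xs" for i j
    using that by (intro slabs_touch_iff[OF assms]) linarith+
  have "region b xs U \<inter> region b xs V \<noteq> {} \<longleftrightarrow>
    (\<exists>i j. i < length xs \<and> j < length xs \<and> xs ! i \<in> U \<and> xs ! j \<in> V \<and>
      slab b (length xs - 1) i \<inter> slab b (length xs - 1) j \<noteq> {})"
    unfolding region_def by blast
  also have "\<dots> \<longleftrightarrow> (\<exists>i j. i < length xs \<and> j < length xs \<and> xs ! i \<in> U \<and> xs ! j \<in> V \<and>
      i \<le> Suc j \<and> j \<le> Suc i)"
    by (simp only: touch cong: conj_cong)
  finally show ?thesis by blast
qed

text \<open>A walk through all edges makes \<open>region\<close> an embedding: consecutive vertices are adjacent, so
  touching slabs belong to adjacent or equal vertices, and every edge is passed, so adjacent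
  vertices touch somewhere. The condition \<open>cut\<close> is connectedness of the graph, in the form in which
  the axiom about a term and its complement provides it.\<close>

lemma frame_true_if_polytopes_true:
  fixes R :: "'w \<Rightarrow> 'w \<Rightarrow> bool"
  assumes true: "true_in (polytope_contact_structure :: 'a::euclidean_space set contact_structure) A"
    and "finite W" "W \<noteq> {}"
    and refl: "\<And>s. s \<in> W \<Longrightarrow> R s s"
    and sym: "\<And>s t. R s t \<Longrightarrow> R t s"
    and cut: "\<And>U. U \<subseteq> W \<Longrightarrow> U \<noteq> {} \<Longrightarrow> U \<noteq> W \<Longrightarrow> \<exists>s\<in>U. \<exists>t\<in>W - U. R s t"
  shows "true_in (frame_structure W R) A"
proof -
  define E where "E = {(s, t). s \<in> W \<and> t \<in> W \<and> R s t}"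
  have EW: "E \<subseteq> W \<times> W" by (auto simp: E_def)
  have "finite E" using EW assms(2) finite_subset by blast
  have conn: "(s, t) \<in> E\<^sup>*" if "s \<in> W" "t \<in> W" for s t
  proof (rule ccontr)
    assume no: "(s, t) \<notin> E\<^sup>*"
    let ?U = "{u \<in> W. (s, u) \<in> E\<^sup>*}"
    have "\<exists>u\<in>?U. \<exists>u'\<in>W - ?U. R u u'"
      using that no by (intro cut) auto
    then obtain u u' where "u \<in> ?U" "u' \<in> W - ?U" "R u u'" by blast
    then have "(u, u') \<in> E" by (auto simp: E_def)
    with \<open>u \<in> ?U\<close> \<open>u' \<in> W - ?U\<close> show False using rtrancl_into_rtrancl by fastforce
  qed
  obtain xs where xs: "xs \<noteq> []" "set xs \<subseteq> W" "successively (\<lambda>s t. (s, t) \<in> E) xs"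
    and edges: "\<And>s t. (s, t) \<in> E \<Longrightarrow> \<exists>ys zs. xs = ys @ s # t # zs"
    using walk_through_edges[OF \<open>finite E\<close> EW assms(3) conn] by metis
  have edge_at: "\<exists>i. Suc i < length xs \<and> xs ! i = s \<and> xs ! Suc i = t" if "s \<in> W" "t \<in> W" "R s t" for s t
  proof -
    have "(s, t) \<in> E" using that by (simp add: E_def)
    then obtain ys zs where "xs = ys @ s # t # zs" using edges by blast
    then show ?thesis by (intro exI[of _ "length ys"]) (simp add: nth_append)
  qed
  have step: "R (xs ! i) (xs ! Suc i)" if "Suc i < length xs" for i
    using xs(3) that by (auto simp: successively_conv_nth E_def)
  have W: "set xs = W"
    using xs(2) edge_at refl by (metis Suc_lessD nth_mem subsetI subset_antisym)
  \<comment> \<open>Loops are edges too, so even the walk in a one-point frame has two vertices.\<close>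
  have len: "1 < length xs"
    using assms(3) edge_at refl by fastforce
  obtain b :: 'a where "b \<in> Basis" using nonempty_Basis by blast
  then have b: "b \<noteq> 0" by (rule nonzero_Basis)
  let ?h = "region b xs" and ?M = "frame_structure W R"
    and ?N = "polytope_contact_structure :: 'a set contact_structure"
  have contact: "(\<exists>s\<in>U. \<exists>t\<in>V. R s t) \<longleftrightarrow> ?h U \<inter> ?h V \<noteq> {}" if "U \<subseteq> W" "V \<subseteq> W" for U V
  proof
    assume "\<exists>s\<in>U. \<exists>t\<in>V. R s t"
    then obtain s t where "s \<in> U" "t \<in> V" "R s t" by blast
    with that edge_at[of s t] obtain i where "Suc i < length xs" "xs ! i \<in> U" "xs ! Suc i \<in> V"
      by blast
    then show "?h U \<inter> ?h V \<noteq> {}"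
      unfolding region_contact[OF b] by (intro exI[of _ i] exI[of _ "Suc i"]) auto
  next
    assume "?h U \<inter> ?h V \<noteq> {}"
    then obtain i j where ij: "i < length xs" "j < length xs" "i \<le> Suc j" "j \<le> Suc i"
      "xs ! i \<in> U" "xs ! j \<in> V"
      unfolding region_contact[OF b] by blast
    then consider "i = j" | "i = Suc j" | "j = Suc i" by linarith
    then have "R (xs ! i) (xs ! j)"
      using ij refl sym step that(1) by cases auto
    with ij show "\<exists>s\<in>U. \<exists>t\<in>V. R s t" by blast
  qed
  have inj: "inj_on ?h (Pow W)"
    using region_mono_iff[OF b, of _ xs] unfolding inj_on_def W by blast
  have "holds ?M v A" if v: "\<forall>i. v i \<in> carr ?M" for v
  proof -
    have "holds ?N (\<lambda>i. ?h (v i)) A \<longleftrightarrow> holds ?M v A"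
      by (rule holds_embedding)
        (use v inj contact in \<open>auto simp: frame_structure_def polytope_contact_structure_def region_Un
          region_compl[OF b xs(1,2)]\<close>)
    moreover have "holds ?N (\<lambda>i. ?h (v i)) A"
      using true region_polytope[OF b len]
      unfolding true_in_def by (simp add: polytope_contact_structure_def)
    ultimately show ?thesis by blast
  qed
  then show ?thesis by (simp add: true_in_def)
qed

section \<open>The canonical frame\<close>

context complete_theory
begin

text \<open>The worlds are the atoms of the subalgebra generated by the variables in the list, coded by
  the valuations that they induce.\<close>

definition worlds :: "nat list \<Rightarrow> nat set set" where
  "worlds vs = {s. s \<subseteq> set vs \<and> \<not> cell (TOne e) vs s \<doteq> TZero e}"

definition adjacent :: "nat list \<Rightarrow> nat set \<Rightarrow> nat set \<Rightarrow> bool" where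
  "adjacent vs s t \<longleftrightarrow> ct (cell (TOne e) vs s) (cell (TOne e) vs t)"

lemma world_if_cell_nonzero:
  assumes "s \<subseteq> set vs" "\<not> cell a vs s \<doteq> TZero e"
  shows "s \<in> worlds vs"
proof -
  have "\<not> cell (TOne e) vs s \<doteq> TZero e"
    using assms(2) le_trans[OF cell_mono[OF le_one] eqv_imp_le, of vs s "TZero e" a]
    by (auto simp: le_zero_iff)
  with assms(1) show ?thesis by (simp add: worlds_def)
qed

lemma cell_decides:
  "trm_vars a \<subseteq> set vs \<Longrightarrow> cell b vs s \<preceq> (if sat s a then a else \<^bold>- a)"
  by (intro decides cell_le_lit) blast

text \<open>A nonzero cell lies below exactly one of \<open>a\<close> and its complement.\<close>

lemma sat_iff_cell_le:
  assumes "trm_vars a \<subseteq> set vs" "\<not> cell b vs s \<doteq> TZero e"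
  shows "sat s a \<longleftrightarrow> cell b vs s \<preceq> a"
  using cell_decides[OF assms(1), of b s] disjoint_if_le_compl[of "cell b vs s" a] assms(2)
  by (auto split: if_splits)

lemma le_if_sat_imp:
  assumes "distinct vs" "trm_vars a \<subseteq> set vs" "trm_vars b \<subseteq> set vs"
    and "\<And>s. s \<in> worlds vs \<Longrightarrow> sat s a \<Longrightarrow> sat s b"
  shows "a \<preceq> b"
proof (rule le_if_diff_zero, rule ccontr)
  assume "\<not> a \<^bold>* (\<^bold>- b) \<doteq> TZero e"
  then obtain s where s: "s \<subseteq> set vs" "\<not> cell (a \<^bold>* (\<^bold>- b)) vs s \<doteq> TZero e"
    by (rule pass_to_cell[where Q = "\<lambda>c. \<not> c \<doteq> TZero e", OF _ assms(1) nonzero_split])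
  have "sat s a" "sat s (\<^bold>- b)"
    using assms(2,3) le_trans[OF cell_le meet_le1] le_trans[OF cell_le meet_le2]
    by (simp_all only: sat_iff_cell_le[OF _ s(2)] trm_vars.simps)
  with assms(4) world_if_cell_nonzero[OF s] show False by simp
qed

lemma eqv_iff_worlds:
  assumes "distinct vs" "trm_vars a \<subseteq> set vs" "trm_vars b \<subseteq> set vs"
  shows "a \<doteq> b \<longleftrightarrow> (\<forall>s\<in>worlds vs. sat s a \<longleftrightarrow> sat s b)"
proof
  assume ab: "a \<doteq> b"
  show "\<forall>s\<in>worlds vs. sat s a \<longleftrightarrow> sat s b"
  proof
    fix s assume "s \<in> worlds vs"
    then have nz: "\<not> cell (TOne e) vs s \<doteq> TZero e" by (simp add: worlds_def)
    show "sat s a \<longleftrightarrow> sat s b"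
      unfolding sat_iff_cell_le[OF assms(2) nz] sat_iff_cell_le[OF assms(3) nz]
      using le_trans[OF _ eqv_imp_le[OF ab]] le_trans[OF _ eqv_imp_le[OF eqv_sym[OF ab]]] by blast
  qed
next
  assume "\<forall>s\<in>worlds vs. sat s a \<longleftrightarrow> sat s b"
  then show "a \<doteq> b"
    using assms by (intro le_antisym le_if_sat_imp[of vs]) auto
qed

text \<open>As contact distributes over joins, two terms in contact contain cells in contact, which are
  then nonzero.\<close>

lemma ct_iff_worlds:
  assumes "distinct vs" "trm_vars a \<subseteq> set vs" "trm_vars b \<subseteq> set vs"
  shows "ct a b \<longleftrightarrow> (\<exists>s\<in>worlds vs. \<exists>t\<in>worlds vs. adjacent vs s t \<and> sat s a \<and> sat t b)"
proof
  assume "ct a b"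
  then obtain s where s: "s \<subseteq> set vs" "ct (cell a vs s) b"
    by (rule pass_to_cell[where Q = "\<lambda>c. ct c b", OF _ assms(1) ct_split])
  from ct_sym[OF s(2)] obtain t where t: "t \<subseteq> set vs" "ct (cell b vs t) (cell a vs s)"
    by (rule pass_to_cell[where Q = "\<lambda>c. ct c (cell a vs s)", OF _ assms(1) ct_split])
  have nz: "\<not> cell a vs s \<doteq> TZero e" "\<not> cell b vs t \<doteq> TZero e"
    using not_ct_null s(2) t(2) by blast+
  have "adjacent vs s t"
    unfolding adjacent_def by (rule ct_mono[OF ct_sym[OF t(2)]]) (intro cell_mono le_one)+
  moreover have "sat s a" "sat t b"
    by (simp_all add: sat_iff_cell_le[OF assms(2) nz(1)] sat_iff_cell_le[OF assms(3) nz(2)] cell_le)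
  ultimately show "\<exists>s\<in>worlds vs. \<exists>t\<in>worlds vs. adjacent vs s t \<and> sat s a \<and> sat t b"
    using world_if_cell_nonzero s(1) t(1) nz by blast
next
  assume "\<exists>s\<in>worlds vs. \<exists>t\<in>worlds vs. adjacent vs s t \<and> sat s a \<and> sat t b"
  then obtain s t where st: "s \<in> worlds vs" "t \<in> worlds vs" "adjacent vs s t" "sat s a" "sat t b"
    by blast
  have "cell (TOne e) vs s \<preceq> a" "cell (TOne e) vs t \<preceq> b"
    using st(1,2,4,5) sat_iff_cell_le[OF assms(2)] sat_iff_cell_le[OF assms(3)]
    unfolding worlds_def by blast+
  with st(3) show "ct a b" unfolding adjacent_def by (rule ct_mono)
qed

lemma mem_iff_holds_frame:
  assumes "distinct vs" "fm_vars A \<subseteq> set vs"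
  shows "A \<in> T \<longleftrightarrow>
    holds (frame_structure (worlds vs) (adjacent vs)) (\<lambda>i. {s \<in> worlds vs. i \<in> s}) A"
proof -
  let ?M = "frame_structure (worlds vs) (adjacent vs)" and ?v = "\<lambda>i. {s \<in> worlds vs. i \<in> s}"
  have tval: "tval ?M ?v a = {s \<in> worlds vs. sat s a}" for a
    by (induction a) (auto simp: frame_structure_def)
  show ?thesis
    using assms(2)
  proof (induction A)
    case (Eq a b)
    then show ?case
      using eqv_iff_worlds[OF assms(1), of a b] by (auto simp: tval eqv_def)
  next
    case (Contact a b)
    then have "Contact a b \<in> T \<longleftrightarrow>
        (\<exists>s\<in>worlds vs. \<exists>t\<in>worlds vs. adjacent vs s t \<and> sat s a \<and> sat t b)"
      using ct_iff_worlds[OF assms(1), of a b] by (simp add: ct_def)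
    then show ?case unfolding holds.simps tval by (auto simp: frame_structure_def)
  qed auto
qed

text \<open>The term that defines \<open>U\<close> is neither zero nor one, so it is in contact with its complement;
  this contact comes from an edge that leaves \<open>U\<close>.\<close>

lemma worlds_connected:
  assumes "distinct vs" "trm_vars e \<subseteq> set vs" "U \<subseteq> worlds vs" "U \<noteq> {}" "U \<noteq> worlds vs"
  shows "\<exists>s\<in>U. \<exists>t\<in>worlds vs - U. adjacent vs s t"
proof -
  have W: "worlds vs \<subseteq> Pow (set vs)" by (auto simp: worlds_def)
  then have "finite U" "U \<subseteq> Pow (set vs)"
    using assms(3) by (auto intro: finite_subset[of U "Pow (set vs)"])
  then obtain a where a: "trm_vars a \<subseteq> set vs" "\<forall>s\<subseteq>set vs. sat s a \<longleftrightarrow> s \<in> U"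
    using assms(2) by (rule term_defining)
  then have sat_a: "s \<in> worlds vs \<Longrightarrow> sat s a \<longleftrightarrow> s \<in> U" for s using W by blast
  have "\<not> a \<doteq> TZero e" "\<not> a \<doteq> TOne e"
    using eqv_iff_worlds[OF assms(1) a(1)] assms(2-5) sat_a by auto
  then have "ct a (\<^bold>- a)" by (rule ct_compl)
  then show ?thesis
    using ct_iff_worlds[OF assms(1) a(1), of "\<^bold>- a"] a(1) sat_a by auto
qed

lemma worlds_nonempty:
  assumes "distinct vs" "trm_vars e \<subseteq> set vs"
  shows "worlds vs \<noteq> {}"
  using eqv_iff_worlds[OF assms(1), of "TZero e" "TOne e"] assms(2) zero_neq_one by auto

end

theorem theorem4p34:
  fixes \<phi> :: fm and e :: trm
  assumes "true_in (polytope_contact_structure :: (real ^ 'n) set contact_structure) \<phi>"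
  shows "F_theorem e \<phi>"
proof (rule ccontr)
  assume "\<not> F_theorem e \<phi>"
  then obtain T where "complete_theory e T" and not_mem: "\<phi> \<notin> T"
    by (rule complete_theory_omitting)
  then interpret complete_theory e T by blast
  \<comment> \<open>The variables of \<open>e\<close> must be decided too, because the constants are written with them.\<close>
  have "finite (fm_vars \<phi> \<union> trm_vars e)"
    by (simp add: finite_fm_vars finite_trm_vars)
  then obtain vs where vs: "set vs = fm_vars \<phi> \<union> trm_vars e" "distinct vs"
    using finite_distinct_list by blast
  have "true_in (frame_structure (worlds vs) (adjacent vs)) \<phi>"
  proof (rule frame_true_if_polytopes_true[OF assms])
    show "finite (worlds vs)"
      by (rule finite_subset[of _ "Pow (set vs)"]) (auto simp: worlds_def)
    show "adjacent vs s s" if "s \<in> worlds vs" for s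
      using that by (auto simp: worlds_def adjacent_def intro: ct_refl)
    show "adjacent vs t s" if "adjacent vs s t" for s t
      using that by (auto simp: adjacent_def intro: ct_sym)
  qed (use vs in \<open>auto intro: worlds_connected simp: worlds_nonempty\<close>)
  then have "holds (frame_structure (worlds vs) (adjacent vs)) (\<lambda>i. {s \<in> worlds vs. i \<in> s}) \<phi>"
    unfolding true_in_def by (auto simp: frame_structure_def)
  with not_mem mem_iff_holds_frame[OF vs(2)] vs(1) show False by blast
qed

end
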